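(* Let $G$ be a group, let $\mu_1,\mu_2,\chi$ be three pairwise different characters of $G$, and put $g:=\frac{\mu_1+\mu_2}{2}$. The solutions $f,g_1,h_1,h_2,h:G\to\mathbb{C}$ of the functional equation $$f(xy)=g_1(x)h_1(y)+g(x)h_2(y)+\chi(x)h(y)\quad\text{for all }x,y\in G$$ are exactly the quintuples $(f,g_1,h_1,h_2,h)$ of one of the following forms: (1) $f=b\chi$, $g_1$ is arbitrary, $h_1=h_2=0$ and $h=b\chi$, where $b\in\mathbb{C}$ is a constant; (2) $f=b\chi$, $g_1=\alpha\mu_1+\alpha\mu_2+\gamma\chi$, $h_1\neq 0$ is arbitrary, $h_2=-2\alpha h_1$ and $h=b\chi-\gamma h_1$, where $b\in\mathbb{C}\setminus\{0\}$ and $\alpha,\gamma\in\mathbb{C}$ are constants; (3) $f=(d_1-d_2)\left(\frac12 a_1\mu_1-\frac12 a_2\mu_2-\frac12 a_3\chi\right)$, $g_1=\frac12 d_1\mu_1+\frac12 d_2\mu_2+d_3\chi$, $h_1=a_1\mu_1+a_2\mu_2$, $h_2=-a_1d_2\mu_1-a_2d_1\mu_2$ and $h=-a_1d_3\mu_1-a_2d_3\mu_2-\frac12 a_3(d_1-d_2)\chi$, where $a_1,a_2,a_3,d_1,d_2,d_3\in\mathbb{C}$ are constants such that $d_1\neq d_2$; (4) $f=a_1b\mu+b\varphi_{\mu,\chi}$, $g_1=-\frac12 a_2\mu_1-\frac12 a_2\mu_2-a_3\chi+a_1\mu+\varphi_{\mu,\chi}$, $h_1=b\mu$, $h_2=a_2b\mu$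 and $h=a_3b\mu+b\varphi_{\mu,\chi}$, where $b\in\mathbb{C}\setminus\{0\}$ and $a_1,a_2,a_3\in\mathbb{C}$ are constants, $\mu$ is a character of $G$, and $\varphi_{\mu,\chi}:G\to\mathbb{C}$ is a solution of $\varphi_{\mu,\chi}(xy)=\varphi_{\mu,\chi}(x)\mu(y)+\chi(x)\varphi_{\mu,\chi}(y)$ for all $x,y\in G$; (5) $f=a_1b\chi$, $g_1=-\frac12 a_2\mu_1-\frac12 a_2\mu_2+(a_1-a_3)\chi$, $h_1$ is arbitrary, $h_2=a_2h_1$ and $h=a_1b\chi-(a_1-a_3)h_1$, where $b\in\mathbb{C}\setminus\{0\}$ and $a_1,a_2,a_3\in\mathbb{C}$ are constants.
   Context: A character of a group $G$ is a homomorphism from $G$ into the multiplicative group $\mathbb{C}^*$ of nonzero complex numbers. "Arbitrary" means an arbitrary function $G\to\mathbb{C}$; $h_1\neq 0$ means that $h_1$ is not the zero function. Within a given form, $\varphi_{\mu,\chi}$ denotes one and the same function at each occurrence. *)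

theory Defs
  imports Complex_Main "HOL-Algebra.Group"
begin

definition complex_units :: "complex monoid" where
  "complex_units = \<lparr>carrier = UNIV - {0}, mult = (*), one = 1\<rparr>"

(* Functions on G are total HOL functions on the ambient type of which only the values on
   carrier G matter; equality and inequality of functions on G is stated on carrier G. *)
definition is_character :: "('a, 'b) monoid_scheme \<Rightarrow> ('a \<Rightarrow> complex) \<Rightarrow> bool" where
  "is_character G \<chi> \<longleftrightarrow> \<chi> \<in> hom G complex_units"

end

theory Submission
  imports Defs
begin

text \<open>
  If \<open>h\<^sub>1 = 0\<close> or \<open>g\<^sub>1\<close> lies in the span of \<open>\<mu>\<^sub>1\<close>, \<open>\<mu>\<^sub>2\<close>, \<open>\<chi>\<close>, then the right-hand side has the shape
  \<open>\<mu>\<^sub>1(x) u(y) + \<mu>\<^sub>2(x) v(y) + \<chi>(x) w(y)\<close>, and linear independence of the characters forces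
  \<open>u\<close>, \<open>v\<close>, \<open>w\<close> to be multiples of \<open>\<mu>\<^sub>1\<close>, \<open>\<mu>\<^sub>2\<close>, \<open>\<chi>\<close>; comparing coefficients yields forms (1), (2),
  (3) and (5). Otherwise even \<open>h\<^sub>1(e) \<noteq> 0\<close>, and putting \<open>y = e\<close> the function \<open>g\<^sub>1\<close>
  can be eliminated: \<open>f(xy) = f(x) m(y) + g(x) k(y) + \<chi>(x) r(y)\<close> with \<open>f\<close> outside the span.
  Expanding \<open>f(xyz)\<close> in two ways shows that \<open>m\<close> is a character, that \<open>r\<close> satisfies the equation
  for \<open>\<phi>\<close>, and that \<open>k(yz) = k(y) m(z) + \<mu>\<^sub>i(y) k(z)\<close> for both \<open>i\<close>, so \<open>k = 0\<close>. This is form (4).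
\<close>

section \<open>Characters of a group and the independence of two of them\<close>

context group
begin

lemma is_character_iff:
  "is_character G \<mu> \<longleftrightarrow>
    (\<forall>x\<in>carrier G. \<mu> x \<noteq> 0) \<and> (\<forall>x\<in>carrier G. \<forall>y\<in>carrier G. \<mu> (x \<otimes> y) = \<mu> x * \<mu> y)"
  by (auto simp: is_character_def hom_def complex_units_def)

lemma is_character_nonzero: "is_character G \<mu> \<Longrightarrow> x \<in> carrier G \<Longrightarrow> \<mu> x \<noteq> 0"
  by (simp add: is_character_iff)

lemma is_character_mult:
  "is_character G \<mu> \<Longrightarrow> x \<in> carrier G \<Longrightarrow> y \<in> carrier G \<Longrightarrow> \<mu> (x \<otimes> y) = \<mu> x * \<mu> y"
  by (simp add: is_character_iff)

lemma is_character_one: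
  assumes "is_character G \<mu>"
  shows "\<mu> \<one> = 1"
  using is_character_mult[OF assms, of \<one> \<one>] is_character_nonzero[OF assms, of \<one>] by simp

text \<open>Nonvanishing comes for free from invertibility:
  \<open>\<mu> x * \<mu> (inv x) = \<mu> \<one> = 1\<close>.\<close>

lemma is_characterI:
  assumes mult: "\<And>x y. x \<in> carrier G \<Longrightarrow> y \<in> carrier G \<Longrightarrow> \<mu> (x \<otimes> y) = \<mu> x * \<mu> y"
    and one: "\<mu> \<one> = 1"
  shows "is_character G \<mu>"
proof -
  have "\<mu> x \<noteq> 0" if "x \<in> carrier G" for x
    using mult[of x "inv x"] one that by auto
  then show ?thesis
    by (simp add: is_character_iff mult)
qed

text \<open>Evaluation at \<open>\<one>\<close> gives \<open>b = - a\<close>; a point where the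
  characters differ then kills \<open>a\<close>.\<close>

lemma two_characters_independent:
  assumes chars: "is_character G \<mu>" "is_character G \<nu>"
    and ne: "\<exists>x\<in>carrier G. \<mu> x \<noteq> \<nu> x"
    and zero: "\<And>x. x \<in> carrier G \<Longrightarrow> a * \<mu> x + b * \<nu> x = 0"
  shows "a = 0" "b = 0"
proof -
  obtain x where x: "x \<in> carrier G" "\<mu> x \<noteq> \<nu> x"
    using ne by blast
  have "a + b = 0"
    using zero[of \<one>] is_character_one[OF chars(1)] is_character_one[OF chars(2)] by simp
  then have b: "b = - a"
    by (simp add: eq_neg_iff_add_eq_0 add.commute)
  then have "a * (\<mu> x - \<nu> x) = 0"
    using zero[OF x(1)] by (simp add: algebra_simps)
  then show "a = 0"
    using x by simp
  then show "b = 0"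
    using b by simp
qed

end

section \<open>Three different characters and their linear span\<close>

locale three_characters = group +
  fixes \<mu>\<^sub>1 \<mu>\<^sub>2 \<chi> :: "'a \<Rightarrow> complex"
  assumes characters: "is_character G \<mu>\<^sub>1" "is_character G \<mu>\<^sub>2" "is_character G \<chi>"
    and different: "\<exists>x\<in>carrier G. \<mu>\<^sub>1 x \<noteq> \<mu>\<^sub>2 x"
      "\<exists>x\<in>carrier G. \<mu>\<^sub>1 x \<noteq> \<chi> x" "\<exists>x\<in>carrier G. \<mu>\<^sub>2 x \<noteq> \<chi> x"
begin

lemmas char_mult = characters[THEN is_character_mult]
lemmas char_one = characters[THEN is_character_one]

text \<open>The classical argument of Dedekind and Artin: the relation at
  \<open>x \<otimes> y\<close> minus \<open>\<chi> y\<close> times the relation at \<open>x\<close>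
  contains no \<open>\<chi> x\<close>, which leaves a relation between two characters for each fixed
  \<open>y\<close>.\<close>

lemma independent:
  assumes zero: "\<And>x. x \<in> carrier G \<Longrightarrow> a * \<mu>\<^sub>1 x + b * \<mu>\<^sub>2 x + c * \<chi> x = 0"
  shows "a = 0" "b = 0" "c = 0"
proof -
  have eliminated: "a * (\<mu>\<^sub>1 y - \<chi> y) * \<mu>\<^sub>1 x + b * (\<mu>\<^sub>2 y - \<chi> y) * \<mu>\<^sub>2 x = 0"
    if x: "x \<in> carrier G" and y: "y \<in> carrier G" for x y
  proof -
    have "(a * \<mu>\<^sub>1 x * \<mu>\<^sub>1 y + b * \<mu>\<^sub>2 x * \<mu>\<^sub>2 y + c * \<chi> x * \<chi> y)
        - (a * \<mu>\<^sub>1 x + b * \<mu>\<^sub>2 x + c * \<chi> x) * \<chi> y = 0"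
      using zero[of "x \<otimes> y"] zero[of x] x y by (simp add: char_mult mult.assoc)
    then show ?thesis
      by (simp add: algebra_simps)
  qed
  \<comment> \<open>For every \<open>y\<close> both coefficients
    \<open>a * (\<mu>\<^sub>1 y - \<chi> y)\<close> and
    \<open>b * (\<mu>\<^sub>2 y - \<chi> y)\<close> vanish; it remains to choose \<open>y\<close>
    with a nonzero second factor.\<close>
  note vanish = two_characters_independent[OF characters(1,2) different(1) eliminated]
  show a: "a = 0"
    using vanish(1) different(2) by auto
  show b: "b = 0"
    using vanish(2) different(3) by auto
  show "c = 0"
    using zero[of \<one>] a b char_one by simp
qed

lemma equal_coefficients:
  assumes "\<And>x. x \<in> carrier G \<Longrightarrow>
      a * \<mu>\<^sub>1 x + b * \<mu>\<^sub>2 x + c * \<chi> x = a' * \<mu>\<^sub>1 x + b' * \<mu>\<^sub>2 x + c' * \<chi> x"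
  shows "a = a'" "b = b'" "c = c'"
proof -
  have "(a - a') * \<mu>\<^sub>1 x + (b - b') * \<mu>\<^sub>2 x + (c - c') * \<chi> x = 0" if "x \<in> carrier G" for x
    using assms[OF that] by (simp add: algebra_simps)
  from independent[OF this] show "a = a'" "b = b'" "c = c'"
    by simp_all
qed

definition in_span :: "('a \<Rightarrow> complex) \<Rightarrow> bool" where
  "in_span u \<longleftrightarrow> (\<exists>a b c. \<forall>x\<in>carrier G. u x = a * \<mu>\<^sub>1 x + b * \<mu>\<^sub>2 x + c * \<chi> x)"

lemma in_spanI:
  assumes "\<And>x. x \<in> carrier G \<Longrightarrow> u x = a * \<mu>\<^sub>1 x + b * \<mu>\<^sub>2 x + c * \<chi> x"
  shows "in_span u"
  using assms unfolding in_span_def by blast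

lemma in_span_if_multiple:
  assumes "t \<noteq> 0"
    and "\<And>x. x \<in> carrier G \<Longrightarrow> t * u x = a * \<mu>\<^sub>1 x + b * \<mu>\<^sub>2 x + c * \<chi> x"
  shows "in_span u"
proof (rule in_spanI)
  fix x
  assume "x \<in> carrier G"
  from assms(2)[OF this] show "u x = a / t * \<mu>\<^sub>1 x + b / t * \<mu>\<^sub>2 x + c / t * \<chi> x"
    using \<open>t \<noteq> 0\<close> by (simp add: field_simps)
qed

text \<open>If \<open>t\<close> and \<open>t'\<close> differed, dividing by \<open>t - t'\<close>
  would express \<open>u\<close> through the characters. Hence the \<open>u\<close> terms cancel and
  independence of the three characters handles the rest.\<close>

lemma equal_coefficients_outside_span:
  assumes u: "\<not> in_span u"
    and eq: "\<And>x. x \<in> carrier G \<Longrightarrow>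
      t * u x + a * \<mu>\<^sub>1 x + b * \<mu>\<^sub>2 x + c * \<chi> x = t' * u x + a' * \<mu>\<^sub>1 x + b' * \<mu>\<^sub>2 x + c' * \<chi> x"
  shows "t = t'" "a = a'" "b = b'" "c = c'"
proof -
  show t: "t = t'"
  proof (rule ccontr)
    assume "t \<noteq> t'"
    then have "t - t' \<noteq> 0"
      by simp
    moreover have "(t - t') * u x = (a' - a) * \<mu>\<^sub>1 x + (b' - b) * \<mu>\<^sub>2 x + (c' - c) * \<chi> x"
      if "x \<in> carrier G" for x
      using eq[OF that] by (simp add: algebra_simps)
    ultimately have "in_span u"
      by (rule in_span_if_multiple)
    with u show False ..
  qed
  have "a * \<mu>\<^sub>1 x + b * \<mu>\<^sub>2 x + c * \<chi> x = a' * \<mu>\<^sub>1 x + b' * \<mu>\<^sub>2 x + c' * \<chi> x" if "x \<in> carrier G" for x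
    using eq[OF that] by (simp add: t add.assoc)
  from equal_coefficients[OF this] show "a = a'" "b = b'" "c = c'"
    by simp_all
qed

section \<open>Functional equations built from the three characters\<close>

text \<open>Setting \<open>y = \<one>\<close> puts \<open>f\<close> in the span with coefficients
  \<open>u \<one>\<close>, \<open>v \<one>\<close>, \<open>w \<one>\<close>. This formula at
  \<open>x \<otimes> y\<close> is compared with the equation, coefficient by coefficient in
  \<open>x\<close> for fixed \<open>y\<close>.\<close>

lemma span_equation:
  assumes eq: "\<And>x y. x \<in> carrier G \<Longrightarrow> y \<in> carrier G \<Longrightarrow>
      f (x \<otimes> y) = \<mu>\<^sub>1 x * u y + \<mu>\<^sub>2 x * v y + \<chi> x * w y"
  obtains a b c where
    "\<And>x. x \<in> carrier G \<Longrightarrow> f x = a * \<mu>\<^sub>1 x + b * \<mu>\<^sub>2 x + c * \<chi> x"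
    "\<And>x. x \<in> carrier G \<Longrightarrow> u x = a * \<mu>\<^sub>1 x"
    "\<And>x. x \<in> carrier G \<Longrightarrow> v x = b * \<mu>\<^sub>2 x"
    "\<And>x. x \<in> carrier G \<Longrightarrow> w x = c * \<chi> x"
proof
  have f: "f x = u \<one> * \<mu>\<^sub>1 x + v \<one> * \<mu>\<^sub>2 x + w \<one> * \<chi> x" if "x \<in> carrier G" for x
    using eq[OF that one_closed] that by (simp add: mult.commute)
  then show "f x = u \<one> * \<mu>\<^sub>1 x + v \<one> * \<mu>\<^sub>2 x + w \<one> * \<chi> x" if "x \<in> carrier G" for x
    using that .
  fix y
  assume y: "y \<in> carrier G"
  have "u y * \<mu>\<^sub>1 x + v y * \<mu>\<^sub>2 x + w y * \<chi> x =
      u \<one> * \<mu>\<^sub>1 y * \<mu>\<^sub>1 x + v \<one> * \<mu>\<^sub>2 y * \<mu>\<^sub>2 x + w \<one> * \<chi> y * \<chi> x" if "x \<in> carrier G" for x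
    using eq[OF that y] f[of "x \<otimes> y"] that y by (simp add: char_mult ac_simps)
  from equal_coefficients[OF this]
  show "u y = u \<one> * \<mu>\<^sub>1 y" "v y = v \<one> * \<mu>\<^sub>2 y" "w y = w \<one> * \<chi> y"
    by simp_all
qed

text \<open>Here the same \<open>u\<close> is a multiple of \<open>\<mu>\<^sub>1\<close> and of
  \<open>\<mu>\<^sub>2\<close>, which is possible only for zero multiples. It serves both the case
  of vanishing \<open>h\<^sub>1\<close> and that of \<open>g\<^sub>1\<close> with equal coefficients
  at \<open>\<mu>\<^sub>1\<close> and \<open>\<mu>\<^sub>2\<close>.\<close>

lemma symmetric_span_equation:
  assumes eq: "\<And>x y. x \<in> carrier G \<Longrightarrow> y \<in> carrier G \<Longrightarrow>
      f (x \<otimes> y) = (\<mu>\<^sub>1 x + \<mu>\<^sub>2 x) * u y + \<chi> x * w y"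
  obtains c where
    "\<And>x. x \<in> carrier G \<Longrightarrow> f x = c * \<chi> x"
    "\<And>x. x \<in> carrier G \<Longrightarrow> u x = 0"
    "\<And>x. x \<in> carrier G \<Longrightarrow> w x = c * \<chi> x"
proof -
  have "f (x \<otimes> y) = \<mu>\<^sub>1 x * u y + \<mu>\<^sub>2 x * u y + \<chi> x * w y"
    if "x \<in> carrier G" "y \<in> carrier G" for x y
    using eq[OF that] by (simp add: algebra_simps)
  then obtain a b c where f: "\<And>x. x \<in> carrier G \<Longrightarrow> f x = a * \<mu>\<^sub>1 x + b * \<mu>\<^sub>2 x + c * \<chi> x"
    and u: "\<And>x. x \<in> carrier G \<Longrightarrow> u x = a * \<mu>\<^sub>1 x" "\<And>x. x \<in> carrier G \<Longrightarrow> u x = b * \<mu>\<^sub>2 x"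
    and w: "\<And>x. x \<in> carrier G \<Longrightarrow> w x = c * \<chi> x"
    using span_equation[of f u u w] by metis
  have "a * \<mu>\<^sub>1 x + (- b) * \<mu>\<^sub>2 x = 0" if "x \<in> carrier G" for x
    using u[OF that] by simp
  from two_characters_independent[OF characters(1,2) different(1) this]
  have "a = 0" "b = 0"
    by simp_all
  with f u w show ?thesis
    by (intro that[of c]) auto
qed

text \<open>By associativity \<open>f (x \<otimes> y \<otimes> z)\<close> has two expansions in
  \<open>f x\<close>, \<open>\<mu>\<^sub>1 x\<close>, \<open>\<mu>\<^sub>2 x\<close>,
  \<open>\<chi> x\<close>, whose coefficients must agree. Since \<open>k\<close> multiplies both
  \<open>\<mu>\<^sub>1\<close> and \<open>\<mu>\<^sub>2\<close>, it obeys two laws that are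
  compatible only if it vanishes.\<close>

lemma equation_outside_span:
  assumes eq: "\<And>x y. x \<in> carrier G \<Longrightarrow> y \<in> carrier G \<Longrightarrow>
      f (x \<otimes> y) = f x * m y + (\<mu>\<^sub>1 x + \<mu>\<^sub>2 x) * k y + \<chi> x * r y"
    and f: "\<not> in_span f"
  shows "x \<in> carrier G \<Longrightarrow> y \<in> carrier G \<Longrightarrow> m (x \<otimes> y) = m x * m y"
    and "x \<in> carrier G \<Longrightarrow> k x = 0"
    and "x \<in> carrier G \<Longrightarrow> y \<in> carrier G \<Longrightarrow> r (x \<otimes> y) = r x * m y + \<chi> x * r y"
proof -
  have compare: "m (y \<otimes> z) = m y * m z" "k (y \<otimes> z) = k y * m z + \<mu>\<^sub>1 y * k z"
      "k (y \<otimes> z) = k y * m z + \<mu>\<^sub>2 y * k z" "r (y \<otimes> z) = r y * m z + \<chi> y * r z"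
    if y: "y \<in> carrier G" and z: "z \<in> carrier G" for y z
  proof -
    have "m (y \<otimes> z) * f x + k (y \<otimes> z) * \<mu>\<^sub>1 x + k (y \<otimes> z) * \<mu>\<^sub>2 x + r (y \<otimes> z) * \<chi> x =
        (m y * m z) * f x + (k y * m z + \<mu>\<^sub>1 y * k z) * \<mu>\<^sub>1 x +
        (k y * m z + \<mu>\<^sub>2 y * k z) * \<mu>\<^sub>2 x + (r y * m z + \<chi> y * r z) * \<chi> x"
      if x: "x \<in> carrier G" for x
    proof -
      have "f x * m (y \<otimes> z) + (\<mu>\<^sub>1 x + \<mu>\<^sub>2 x) * k (y \<otimes> z) + \<chi> x * r (y \<otimes> z) = f (x \<otimes> (y \<otimes> z))"
        using eq x y z by simp
      also have "\<dots> = f ((x \<otimes> y) \<otimes> z)"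
        using x y z by (simp add: m_assoc)
      also have "\<dots> = f (x \<otimes> y) * m z + (\<mu>\<^sub>1 x * \<mu>\<^sub>1 y + \<mu>\<^sub>2 x * \<mu>\<^sub>2 y) * k z + \<chi> x * \<chi> y * r z"
        using eq[of "x \<otimes> y" z] x y z by (simp add: char_mult)
      finally show ?thesis
        using eq[OF x y] by (simp add: algebra_simps)
    qed
    from equal_coefficients_outside_span[OF f this]
    show "m (y \<otimes> z) = m y * m z" "k (y \<otimes> z) = k y * m z + \<mu>\<^sub>1 y * k z"
      "k (y \<otimes> z) = k y * m z + \<mu>\<^sub>2 y * k z" "r (y \<otimes> z) = r y * m z + \<chi> y * r z"
      by simp_all
  qed
  show "k x = 0" if x: "x \<in> carrier G"
  proof -
    obtain y where y: "y \<in> carrier G" "\<mu>\<^sub>1 y \<noteq> \<mu>\<^sub>2 y"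
      using different(1) by blast
    have "\<mu>\<^sub>1 y * k x = \<mu>\<^sub>2 y * k x"
      using compare(2,3)[OF y(1) x] by (metis add_left_cancel)
    then show ?thesis
      using y(2) by simp
  qed
  show "m (x \<otimes> y) = m x * m y" "r (x \<otimes> y) = r x * m y + \<chi> x * r y"
    if "x \<in> carrier G" "y \<in> carrier G"
    using compare[OF that] by simp_all
qed

end

section \<open>Classification of the solutions\<close>

theorem theorem4p3:
  fixes G :: "('a, 'b) monoid_scheme" (structure)
    and \<mu>\<^sub>1 \<mu>\<^sub>2 \<chi> g f g\<^sub>1 h\<^sub>1 h\<^sub>2 h :: "'a \<Rightarrow> complex"
  assumes group: "group G"
    and characters: "is_character G \<mu>\<^sub>1" "is_character G \<mu>\<^sub>2" "is_character G \<chi>"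
    and different: "\<exists>x\<in>carrier G. \<mu>\<^sub>1 x \<noteq> \<mu>\<^sub>2 x"
      "\<exists>x\<in>carrier G. \<mu>\<^sub>1 x \<noteq> \<chi> x" "\<exists>x\<in>carrier G. \<mu>\<^sub>2 x \<noteq> \<chi> x"
    and g: "\<forall>x\<in>carrier G. g x = (\<mu>\<^sub>1 x + \<mu>\<^sub>2 x) / 2"
  shows "(\<forall>x\<in>carrier G. \<forall>y\<in>carrier G.
            f (x \<otimes> y) = g\<^sub>1 x * h\<^sub>1 y + g x * h\<^sub>2 y + \<chi> x * h y)
    \<longleftrightarrow>
      (\<exists>b.
         \<forall>x\<in>carrier G. f x = b * \<chi> x \<and> h\<^sub>1 x = 0 \<and> h\<^sub>2 x = 0 \<and> h x = b * \<chi> x)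
    \<or> (\<exists>b \<alpha> \<gamma>. b \<noteq> 0 \<and> (\<exists>x\<in>carrier G. h\<^sub>1 x \<noteq> 0) \<and>
         (\<forall>x\<in>carrier G.
            f x = b * \<chi> x \<and>
            g\<^sub>1 x = \<alpha> * \<mu>\<^sub>1 x + \<alpha> * \<mu>\<^sub>2 x + \<gamma> * \<chi> x \<and>
            h\<^sub>2 x = - 2 * \<alpha> * h\<^sub>1 x \<and>
            h x = b * \<chi> x - \<gamma> * h\<^sub>1 x))
    \<or> (\<exists>a\<^sub>1 a\<^sub>2 a\<^sub>3 d\<^sub>1 d\<^sub>2 d\<^sub>3. d\<^sub>1 \<noteq> d\<^sub>2 \<and>
         (\<forall>x\<in>carrier G.
            f x = (d\<^sub>1 - d\<^sub>2) * (1/2 * a\<^sub>1 * \<mu>\<^sub>1 x - 1/2 * a\<^sub>2 * \<mu>\<^sub>2 x - 1/2 * a\<^sub>3 * \<chi> x) \<and>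
            g\<^sub>1 x = 1/2 * d\<^sub>1 * \<mu>\<^sub>1 x + 1/2 * d\<^sub>2 * \<mu>\<^sub>2 x + d\<^sub>3 * \<chi> x \<and>
            h\<^sub>1 x = a\<^sub>1 * \<mu>\<^sub>1 x + a\<^sub>2 * \<mu>\<^sub>2 x \<and>
            h\<^sub>2 x = - a\<^sub>1 * d\<^sub>2 * \<mu>\<^sub>1 x - a\<^sub>2 * d\<^sub>1 * \<mu>\<^sub>2 x \<and>
            h x = - a\<^sub>1 * d\<^sub>3 * \<mu>\<^sub>1 x - a\<^sub>2 * d\<^sub>3 * \<mu>\<^sub>2 x - 1/2 * a\<^sub>3 * (d\<^sub>1 - d\<^sub>2) * \<chi> x))
    \<or> (\<exists>b a\<^sub>1 a\<^sub>2 a\<^sub>3 \<mu> \<phi>. b \<noteq> 0 \<and> is_character G \<mu> \<and>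
         (\<forall>x\<in>carrier G. \<forall>y\<in>carrier G. \<phi> (x \<otimes> y) = \<phi> x * \<mu> y + \<chi> x * \<phi> y) \<and>
         (\<forall>x\<in>carrier G.
            f x = a\<^sub>1 * b * \<mu> x + b * \<phi> x \<and>
            g\<^sub>1 x = - (1/2) * a\<^sub>2 * \<mu>\<^sub>1 x - 1/2 * a\<^sub>2 * \<mu>\<^sub>2 x - a\<^sub>3 * \<chi> x + a\<^sub>1 * \<mu> x + \<phi> x \<and>
            h\<^sub>1 x = b * \<mu> x \<and>
            h\<^sub>2 x = a\<^sub>2 * b * \<mu> x \<and>
            h x = a\<^sub>3 * b * \<mu> x + b * \<phi> x))
    \<or> (\<exists>b a\<^sub>1 a\<^sub>2 a\<^sub>3. b \<noteq> 0 \<and>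
         (\<forall>x\<in>carrier G.
            f x = a\<^sub>1 * b * \<chi> x \<and>
            g\<^sub>1 x = - (1/2) * a\<^sub>2 * \<mu>\<^sub>1 x - 1/2 * a\<^sub>2 * \<mu>\<^sub>2 x + (a\<^sub>1 - a\<^sub>3) * \<chi> x \<and>
            h\<^sub>2 x = a\<^sub>2 * h\<^sub>1 x \<and>
            h x = a\<^sub>1 * b * \<chi> x - (a\<^sub>1 - a\<^sub>3) * h\<^sub>1 x))"
  (is "?eq \<longleftrightarrow> ?F1 \<or> ?F2 \<or> ?F3 \<or> ?F4 \<or> ?F5")
proof -
  interpret three_characters G \<mu>\<^sub>1 \<mu>\<^sub>2 \<chi>
    using group characters different
    by (simp add: three_characters_def three_characters_axioms_def)
  show ?thesis
  proof
    assume ?eq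
    then have eq: "f (x \<otimes> y) = g\<^sub>1 x * h\<^sub>1 y + (\<mu>\<^sub>1 x + \<mu>\<^sub>2 x) * (h\<^sub>2 y / 2) + \<chi> x * h y"
      if "x \<in> carrier G" "y \<in> carrier G" for x y
      \<comment> \<open>The factor 1/2 of \<open>g\<close> is moved to \<open>h\<^sub>2\<close>, so
        that the plain sum of characters appears.\<close>
      using g that by simp
    consider (zero) "\<forall>x\<in>carrier G. h\<^sub>1 x = 0"
      | (span) "in_span g\<^sub>1" "\<exists>x\<in>carrier G. h\<^sub>1 x \<noteq> 0"
      | (outside) "\<not> in_span g\<^sub>1" "\<exists>x\<in>carrier G. h\<^sub>1 x \<noteq> 0"
      by blast
    then show "?F1 \<or> ?F2 \<or> ?F3 \<or> ?F4 \<or> ?F5"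
    proof cases
      case zero
      have "f (x \<otimes> y) = (\<mu>\<^sub>1 x + \<mu>\<^sub>2 x) * (h\<^sub>2 y / 2) + \<chi> x * h y"
        if "x \<in> carrier G" "y \<in> carrier G" for x y
        using eq[OF that] zero that by simp
      then obtain c where "\<And>x. x \<in> carrier G \<Longrightarrow> f x = c * \<chi> x"
        "\<And>x. x \<in> carrier G \<Longrightarrow> h\<^sub>2 x / 2 = 0" "\<And>x. x \<in> carrier G \<Longrightarrow> h x = c * \<chi> x"
        using symmetric_span_equation[of f "\<lambda>x. h\<^sub>2 x / 2" h] by metis
      with zero have ?F1
        by (intro exI[of _ c]) auto
      then show ?thesis ..
    next
      case span
      then obtain d\<^sub>1 d\<^sub>2 d\<^sub>3
        where g\<^sub>1: "\<And>x. x \<in> carrier G \<Longrightarrow> g\<^sub>1 x = d\<^sub>1 * \<mu>\<^sub>1 x + d\<^sub>2 * \<mu>\<^sub>2 x + d\<^sub>3 * \<chi> x"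
        unfolding in_span_def by blast
      show ?thesis
      \<comment> \<open>With equal coefficients \<open>\<mu>\<^sub>1\<close> and
        \<open>\<mu>\<^sub>2\<close> occur only through their sum; with different ones the equation
        determines \<open>h\<^sub>1\<close> and \<open>h\<^sub>2\<close> separately.\<close>
      proof (cases "d\<^sub>1 = d\<^sub>2")
        case True
        have "f (x \<otimes> y) = (\<mu>\<^sub>1 x + \<mu>\<^sub>2 x) * (d\<^sub>1 * h\<^sub>1 y + h\<^sub>2 y / 2) + \<chi> x * (d\<^sub>3 * h\<^sub>1 y + h y)"
          if "x \<in> carrier G" "y \<in> carrier G" for x y
          using eq[OF that] g\<^sub>1[OF that(1)] True by (simp add: algebra_simps)
        then obtain c where f: "\<And>x. x \<in> carrier G \<Longrightarrow> f x = c * \<chi> x"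
          and h2': "\<And>x. x \<in> carrier G \<Longrightarrow> d\<^sub>1 * h\<^sub>1 x + h\<^sub>2 x / 2 = 0"
          and h': "\<And>x. x \<in> carrier G \<Longrightarrow> d\<^sub>3 * h\<^sub>1 x + h x = c * \<chi> x"
          using symmetric_span_equation
            [of f "\<lambda>x. d\<^sub>1 * h\<^sub>1 x + h\<^sub>2 x / 2" "\<lambda>x. d\<^sub>3 * h\<^sub>1 x + h x"] by metis
        have h\<^sub>2: "h\<^sub>2 x = - 2 * d\<^sub>1 * h\<^sub>1 x" if "x \<in> carrier G" for x
          using h2'[OF that] by (simp add: field_simps eq_neg_iff_add_eq_0)
        have h: "h x = c * \<chi> x - d\<^sub>3 * h\<^sub>1 x" if "x \<in> carrier G" for x
          using h'[OF that] by (simp add: eq_diff_eq add.commute)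
        show ?thesis
        proof (cases "c = 0")
          case False
          have ?F2
            by (rule exI[of _ c], rule exI[of _ d\<^sub>1], rule exI[of _ d\<^sub>3])
              (use False span(2) f g\<^sub>1 True h\<^sub>2 h in auto)
          then show ?thesis by blast
        next
          case c: True
          \<comment> \<open>Form (2) demands a nonzero \<open>b\<close>, so \<open>c = 0\<close>
            goes to form (5) with \<open>a\<^sub>1 = 0\<close>. There \<open>b\<close> enters only
            through \<open>a\<^sub>1 * b\<close>, and 1 is an arbitrary nonzero choice.\<close>
          have ?F5
            by (rule exI[of _ 1], rule exI[of _ 0], rule exI[of _ "- 2 * d\<^sub>1"], rule exI[of _ "- d\<^sub>3"])
              (use c f g\<^sub>1 True h\<^sub>2 h in auto)
          then show ?thesis by blast
        qed
      next
        case False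
        \<comment> \<open>These collect the coefficients of \<open>\<mu>\<^sub>1 x\<close>,
          \<open>\<mu>\<^sub>2 x\<close> and \<open>\<chi> x\<close>.\<close>
        define u v w where "u y = d\<^sub>1 * h\<^sub>1 y + h\<^sub>2 y / 2" and "v y = d\<^sub>2 * h\<^sub>1 y + h\<^sub>2 y / 2"
          and "w y = d\<^sub>3 * h\<^sub>1 y + h y" for y
        have "f (x \<otimes> y) = \<mu>\<^sub>1 x * u y + \<mu>\<^sub>2 x * v y + \<chi> x * w y"
          if "x \<in> carrier G" "y \<in> carrier G" for x y
          using eq[OF that] g\<^sub>1[OF that(1)] by (simp add: u_def v_def w_def algebra_simps)
        then obtain a b c
          where f: "\<And>x. x \<in> carrier G \<Longrightarrow> f x = a * \<mu>\<^sub>1 x + b * \<mu>\<^sub>2 x + c * \<chi> x"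
            and u: "\<And>x. x \<in> carrier G \<Longrightarrow> u x = a * \<mu>\<^sub>1 x"
            and v: "\<And>x. x \<in> carrier G \<Longrightarrow> v x = b * \<mu>\<^sub>2 x"
            and w: "\<And>x. x \<in> carrier G \<Longrightarrow> w x = c * \<chi> x"
          using span_equation[of f u v w] by metis
        define D where "D = d\<^sub>1 - d\<^sub>2"
        have D: "D \<noteq> 0"
          using False by (simp add: D_def)
        have h\<^sub>1: "h\<^sub>1 x = a / D * \<mu>\<^sub>1 x + - b / D * \<mu>\<^sub>2 x" if "x \<in> carrier G" for x
        proof -
          \<comment> \<open>The difference eliminates \<open>h\<^sub>2\<close>; the combination used
            below for \<open>h\<^sub>2\<close> eliminates \<open>h\<^sub>1\<close> in the same
            way.\<close>
          have "D * h\<^sub>1 x = u x - v x"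
            by (simp add: D_def u_def v_def algebra_simps)
          then show ?thesis
            using D u[OF that] v[OF that] by (simp add: field_simps)
        qed
        have h\<^sub>2: "h\<^sub>2 x = - (a / D) * (2 * d\<^sub>2) * \<mu>\<^sub>1 x - (- b / D) * (2 * d\<^sub>1) * \<mu>\<^sub>2 x"
          if "x \<in> carrier G" for x
        proof -
          have "D * h\<^sub>2 x = 2 * (d\<^sub>1 * v x - d\<^sub>2 * u x)"
            by (simp add: D_def u_def v_def algebra_simps)
          then show ?thesis
            using D u[OF that] v[OF that] by (simp add: field_simps)
        qed
        have h: "h x = - (a / D) * d\<^sub>3 * \<mu>\<^sub>1 x - (- b / D) * d\<^sub>3 * \<mu>\<^sub>2 x + c * \<chi> x"
          if "x \<in> carrier G" for x
        proof -
          have "h x = c * \<chi> x - d\<^sub>3 * h\<^sub>1 x"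
            using w[OF that] by (simp add: w_def eq_diff_eq add.commute)
          then show ?thesis
            by (simp add: h\<^sub>1[OF that] algebra_simps)
        qed
        \<comment> \<open>The first two span coefficients of \<open>g\<^sub>1\<close> are doubled
          because form (3) halves them. The sign in \<open>- c / D\<close> offsets the minus before
          the \<open>\<chi>\<close> term of \<open>f\<close>.\<close>
        have ?F3
        proof (rule exI[of _ "a / D"], rule exI[of _ "- b / D"], rule exI[of _ "- c / D"],
            rule exI[of _ "2 * d\<^sub>1"], rule exI[of _ "2 * d\<^sub>2"], rule exI[of _ d\<^sub>3], intro conjI ballI)
          have diff: "2 * d\<^sub>1 - 2 * d\<^sub>2 = 2 * D"
            by (simp add: D_def)
          fix x
          assume x: "x \<in> carrier G"
          show "f x = (2 * d\<^sub>1 - 2 * d\<^sub>2) *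
              (1/2 * (a / D) * \<mu>\<^sub>1 x - 1/2 * (- b / D) * \<mu>\<^sub>2 x - 1/2 * (- c / D) * \<chi> x)"
            unfolding diff f[OF x] using D by (simp add: field_simps)
          show "h x = - (a / D) * d\<^sub>3 * \<mu>\<^sub>1 x - (- b / D) * d\<^sub>3 * \<mu>\<^sub>2 x
              - 1/2 * (- c / D) * (2 * d\<^sub>1 - 2 * d\<^sub>2) * \<chi> x"
            unfolding diff h[OF x] using D by simp
        qed (use False g\<^sub>1 h\<^sub>1 h\<^sub>2 in auto)
        then show ?thesis by blast
      qed
    next
      case outside
      have f_one: "f x = g\<^sub>1 x * h\<^sub>1 \<one> + (\<mu>\<^sub>1 x + \<mu>\<^sub>2 x) * (h\<^sub>2 \<one> / 2) + \<chi> x * h \<one>"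
        if "x \<in> carrier G" for x
        using eq[OF that one_closed] that by simp
      define b where "b = h\<^sub>1 \<one>"
      \<comment> \<open>Otherwise \<open>y = \<one>\<close> puts \<open>f\<close> in the span, and
        the equation at a point \<open>y\<close> with \<open>h\<^sub>1 y \<noteq> 0\<close> can be
        solved for \<open>g\<^sub>1\<close>, putting it in the span as well.\<close>
      have b: "b \<noteq> 0"
      proof
        assume "b = 0"
        then have f: "f x = h\<^sub>2 \<one> / 2 * \<mu>\<^sub>1 x + h\<^sub>2 \<one> / 2 * \<mu>\<^sub>2 x + h \<one> * \<chi> x"
          if "x \<in> carrier G" for x
          using f_one[OF that] by (simp add: b_def algebra_simps)
        obtain y where y: "y \<in> carrier G" "h\<^sub>1 y \<noteq> 0"
          using outside(2) by blast
        have "h\<^sub>1 y * g\<^sub>1 x = (h\<^sub>2 \<one> / 2 * \<mu>\<^sub>1 y - h\<^sub>2 y / 2) * \<mu>\<^sub>1 x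
            + (h\<^sub>2 \<one> / 2 * \<mu>\<^sub>2 y - h\<^sub>2 y / 2) * \<mu>\<^sub>2 x + (h \<one> * \<chi> y - h y) * \<chi> x"
          if "x \<in> carrier G" for x
          using eq[OF that y(1)] f[of "x \<otimes> y"] that y(1) by (simp add: char_mult algebra_simps)
        with y(2) have "in_span g\<^sub>1"
          by (rule in_span_if_multiple)
        with outside(1) show False ..
      qed
      \<comment> \<open>Solving \<open>f_one\<close> for \<open>g\<^sub>1 x\<close> and substituting
        into the equation produces \<open>m\<close>, \<open>k\<close> and \<open>r\<close> as the
        coefficients of \<open>f x\<close>, \<open>\<mu>\<^sub>1 x + \<mu>\<^sub>2 x\<close> and
        \<open>\<chi> x\<close>.\<close>
      define m where "m y = h\<^sub>1 y / b" for y
      define k where "k y = h\<^sub>2 y / 2 - h\<^sub>2 \<one> / 2 * m y" for y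
      define r where "r y = h y - h \<one> * m y" for y
      \<comment> \<open>Modulo the span, \<open>f\<close> is the nonzero multiple \<open>b\<close>
        of \<open>g\<^sub>1\<close>.\<close>
      have f_span: "\<not> in_span f"
      proof
        assume "in_span f"
        then obtain p q s where f: "\<And>x. x \<in> carrier G \<Longrightarrow> f x = p * \<mu>\<^sub>1 x + q * \<mu>\<^sub>2 x + s * \<chi> x"
          unfolding in_span_def by blast
        have "b * g\<^sub>1 x = (p - h\<^sub>2 \<one> / 2) * \<mu>\<^sub>1 x + (q - h\<^sub>2 \<one> / 2) * \<mu>\<^sub>2 x + (s - h \<one>) * \<chi> x"
          if "x \<in> carrier G" for x
          using f_one[OF that] f[OF that] by (simp add: b_def algebra_simps)
        with b have "in_span g\<^sub>1"
          by (rule in_span_if_multiple)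
        with outside(1) show False ..
      qed
      have f_eq: "f (x \<otimes> y) = f x * m y + (\<mu>\<^sub>1 x + \<mu>\<^sub>2 x) * k y + \<chi> x * r y"
        if "x \<in> carrier G" "y \<in> carrier G" for x y
      proof -
        have "h\<^sub>1 y = b * m y"
          using b by (simp add: m_def)
        then show ?thesis
          using eq[OF that] f_one[OF that(1)] by (simp add: k_def r_def b_def algebra_simps)
      qed
      have laws: "m (x \<otimes> y) = m x * m y" "k x = 0" "r (x \<otimes> y) = r x * m y + \<chi> x * r y"
        if "x \<in> carrier G" "y \<in> carrier G" for x y
        using equation_outside_span[of f m k r] f_eq f_span that by blast+
      have m_one: "m \<one> = 1"
        using b by (simp add: m_def b_def)
      have f: "f x = f \<one> * m x + r x" if "x \<in> carrier G" for x
        using f_eq[OF one_closed that] laws(2)[OF that that] that char_one by simp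
      \<comment> \<open>The constants are the values of \<open>f\<close>, \<open>h\<^sub>2\<close>,
        \<open>h\<close> at \<open>\<one>\<close>, divided by \<open>b\<close>. Dividing
        \<open>r\<close> by \<open>b\<close> keeps its equation, which is linear in
        \<open>r\<close>, and gives \<open>g\<^sub>1\<close> the summand \<phi> with coefficient
        1.\<close>
      have ?F4
      proof (rule exI[of _ b], rule exI[of _ "f \<one> / b"], rule exI[of _ "h\<^sub>2 \<one> / b"],
          rule exI[of _ "h \<one> / b"], rule exI[of _ m], rule exI[of _ "\<lambda>x. r x / b"],
          intro conjI ballI)
        show "is_character G m"
          using laws(1) m_one by (rule is_characterI)
        fix x
        assume x: "x \<in> carrier G"
        show "r (x \<otimes> y) / b = r x / b * m y + \<chi> x * (r y / b)" if "y \<in> carrier G" for y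
          using laws(3)[OF x that] by (simp add: add_divide_distrib)
        show "f x = f \<one> / b * b * m x + b * (r x / b)"
          using f[OF x] b by simp
        show "h\<^sub>1 x = b * m x"
          using b by (simp add: m_def)
        show "h\<^sub>2 x = h\<^sub>2 \<one> / b * b * m x"
          using laws(2)[OF x x] b by (simp add: k_def)
        show "h x = h \<one> / b * b * m x + b * (r x / b)"
          using b by (simp add: r_def)
        have "b * g\<^sub>1 x = f \<one> * m x + r x - (\<mu>\<^sub>1 x + \<mu>\<^sub>2 x) * (h\<^sub>2 \<one> / 2) - \<chi> x * h \<one>"
          using f_one[OF x] f[OF x] by (simp add: b_def algebra_simps)
        then have "g\<^sub>1 x = (f \<one> * m x + r x - (\<mu>\<^sub>1 x + \<mu>\<^sub>2 x) * (h\<^sub>2 \<one> / 2) - \<chi> x * h \<one>) / b"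
          using b by (simp add: nonzero_eq_divide_eq mult.commute)
        then show "g\<^sub>1 x = - (1/2) * (h\<^sub>2 \<one> / b) * \<mu>\<^sub>1 x - 1/2 * (h\<^sub>2 \<one> / b) * \<mu>\<^sub>2 x
            - h \<one> / b * \<chi> x + f \<one> / b * m x + r x / b"
          by (simp add: add_divide_distrib diff_divide_distrib algebra_simps)
      qed (rule b)
      then show ?thesis by blast
    qed
  next
    assume "?F1 \<or> ?F2 \<or> ?F3 \<or> ?F4 \<or> ?F5"
    then show ?eq
    \<comment> \<open>Each form is checked by substitution: multiplicativity of the characters, and
      in (4) the equation for \<phi>, reduces the claim to field arithmetic.\<close>
    proof (elim disjE)
      assume ?F1
      then show ?eq
        by (elim exE) (simp add: char_mult)
    next
      assume ?F2
      then show ?eq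
        by (elim exE conjE) (simp add: char_mult g, simp add: algebra_simps add_divide_distrib)
    next
      assume ?F3
      then show ?eq
        by (elim exE conjE) (simp add: char_mult g, simp add: field_simps)
    next
      assume ?F4
      then show ?eq
        by (elim exE conjE) (simp add: char_mult is_character_mult g, simp add: field_simps)
    next
      assume ?F5
      then show ?eq
        by (elim exE conjE) (simp add: char_mult g, simp add: field_simps)
    qed
  qed
qed

end
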